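(* For every distance parameter $\epsilon>0$, the property $\mathcal{P}_{(100)\text{-FREE}}$ of $(1,0,0)$-free Boolean functions is testable with query complexity $O(1/\epsilon^2)$ (with one-sided error).
   Context: A function $f:\mathbb{F}_2^n\to\{0,1\}$ is $(1,0,0)$-free if for all $x,y\in\mathbb{F}_2^n$, the multiset $(f(x),f(y),f(x+y))$ is not equal to the multiset $(1,0,0)$ (i.e., it is never the case that exactly one of the three values is $1$). $\mathcal{P}_{(100)\text{-FREE}}$ is the set of all such functions (over all $n$). $\mathrm{dist}(f,g)=\Pr_x[f(x)\neq g(x)]$ for uniform $x\in\mathbb{F}_2^n$ and $\mathrm{dist}(f,\mathcal{P})=\min_{g\in\mathcal{P}}\mathrm{dist}(f,g)$. A tester with query complexity $q(\epsilon)$ makes at most $q(\epsilon)$ queries to $f$, accepts with probability $1$ if $f\in\mathcal{P}$, and accepts with probability at most $1/3$ if $\mathrm{dist}(f,\mathcal{P})\geq\epsilon$. *)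

theory Defs
  imports
    "HOL-Library.Z2"
    "HOL-Library.Multiset"
    "HOL-Library.FuncSet"
    "HOL-Probability.Probability_Mass_Function"
    "Jordan_Normal_Form.Matrix"
begin

text \<open>
  The dimension \<open>n\<close> is quantified inside the notion of testability (one query bound has to
  serve all \<open>n\<close>), hence vectors with an explicit carrier instead of a type-indexed dimension.
\<close>

type_synonym f2vec = "bit Matrix.vec"

abbreviation F2 :: "nat \<Rightarrow> f2vec set" where
  "F2 n \<equiv> carrier_vec n"

definition boolean_functions :: "nat \<Rightarrow> (f2vec \<Rightarrow> bool) set" where
  "boolean_functions n = F2 n \<rightarrow>\<^sub>E UNIV"

text \<open>The values 1 and 0 are rendered as \<^const>\<open>True\<close> and \<^const>\<open>False\<close>. A property assigns
  to each \<open>n\<close> its members among the functions on \<open>F2 n\<close>.\<close>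

type_synonym f2_property = "nat \<Rightarrow> (f2vec \<Rightarrow> bool) set"

definition free_100 :: f2_property where
  "free_100 n = {f \<in> boolean_functions n.
     \<forall>x \<in> F2 n. \<forall>y \<in> F2 n. {#f x, f y, f (x + y)#} \<noteq> {#True, False, False#}}"

definition fun_dist :: "nat \<Rightarrow> (f2vec \<Rightarrow> bool) \<Rightarrow> (f2vec \<Rightarrow> bool) \<Rightarrow> real" where
  "fun_dist n f g = measure_pmf.prob (pmf_of_set (F2 n)) {x. f x \<noteq> g x}"

definition property_dist :: "nat \<Rightarrow> (f2vec \<Rightarrow> bool) \<Rightarrow> f2_property \<Rightarrow> real" where
  "property_dist n f P = Min (fun_dist n f ` P n)"

text \<open>
  A deterministic, possibly adaptive, query algorithm is a decision tree: \<open>Query x t0 t1\<close> asks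
  for \<open>f x\<close> and continues with \<open>t0\<close> on answer 0 and with \<open>t1\<close> on answer 1. A randomized
  one is a probability distribution on decision trees.
\<close>

datatype 'a query_tree = Answer bool | Query 'a "'a query_tree" "'a query_tree"

primrec accepts :: "'a query_tree \<Rightarrow> ('a \<Rightarrow> bool) \<Rightarrow> bool" where
  "accepts (Answer b) f = b"
| "accepts (Query x t0 t1) f = (if f x then accepts t1 f else accepts t0 f)"

primrec max_queries :: "'a query_tree \<Rightarrow> nat" where
  "max_queries (Answer b) = 0"
| "max_queries (Query x t0 t1) = Suc (max (max_queries t0) (max_queries t1))"

text \<open>Here \<^term>\<open>set_query_tree t\<close> is the set of points at which \<open>t\<close> may query.\<close>

definition one_sided_tester ::
  "f2_property \<Rightarrow> nat \<Rightarrow> real \<Rightarrow> nat \<Rightarrow> f2vec query_tree pmf \<Rightarrow> bool" where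
  "one_sided_tester P n \<epsilon> k T \<longleftrightarrow>
     (\<forall>t \<in> set_pmf T. set_query_tree t \<subseteq> F2 n \<and> max_queries t \<le> k) \<and>
     (\<forall>f \<in> P n. measure_pmf.prob T {t. accepts t f} = 1) \<and>
     (\<forall>f \<in> boolean_functions n. property_dist n f P \<ge> \<epsilon> \<longrightarrow>
        measure_pmf.prob T {t. accepts t f} \<le> 1 / 3)"

definition testable_with :: "f2_property \<Rightarrow> (real \<Rightarrow> nat) \<Rightarrow> bool" where
  "testable_with P q \<longleftrightarrow>
     (\<exists>T :: real \<Rightarrow> nat \<Rightarrow> f2vec query_tree pmf.
        \<forall>\<epsilon> > 0. \<forall>n. one_sided_tester P n \<epsilon> (q \<epsilon>) (T \<epsilon> n))"

text \<open>The following facts make \<^const>\<open>pmf_of_set\<close> and \<^const>\<open>Min\<close> above well defined.\<close>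

lemma finite_F2: "finite (F2 n)"
proof -
  have "F2 n \<subseteq> (\<lambda>f. Matrix.vec n f) ` ({..<n} \<rightarrow>\<^sub>E (UNIV :: bit set))"
  proof
    fix v :: f2vec assume v: "v \<in> F2 n"
    have "v = Matrix.vec n (restrict (\<lambda>i. vec_index v i) {..<n})"
      using v by (intro eq_vecI) auto
    moreover have "restrict (\<lambda>i. vec_index v i) {..<n} \<in> {..<n} \<rightarrow>\<^sub>E UNIV"
      by auto
    ultimately show "v \<in> (\<lambda>f. Matrix.vec n f) ` ({..<n} \<rightarrow>\<^sub>E (UNIV :: bit set))"
      by (rule image_eqI)
  qed
  moreover have "finite (UNIV :: bit set)"
  proof (rule finite_subset)
    show "(UNIV :: bit set) \<subseteq> {0, 1}" by (metis bit_not_one_iff insertCI subsetI)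
  qed simp
  ultimately show ?thesis by (meson finite_PiE finite_imageI finite_lessThan finite_subset)
qed

lemma F2_nonempty: "F2 n \<noteq> {}"
  using zero_carrier_vec by blast

lemma finite_free_100: "finite (free_100 n)"
  unfolding free_100_def boolean_functions_def by (simp add: finite_F2 finite_PiE)

lemma free_100_nonempty: "free_100 n \<noteq> {}"
proof -
  have "restrict (\<lambda>_. False) (F2 n) \<in> free_100 n"
    unfolding free_100_def boolean_functions_def by auto
  then show ?thesis by blast
qed

end

theory Submission
  imports Defs "HOL-Probability.Product_PMF"
begin

text \<open>
  A function is \<open>(1,0,0)\<close>-free iff its zero set is closed under addition, i.e. is empty or a
  subspace. The tester picks \<open>O(1/\<epsilon>\<^sup>2)\<close> random pairs \<open>x, y\<close> and rejects on seeing
  \<open>f x = f y = 0\<close> and \<open>f (x + y) = 1\<close>. Let \<open>Z\<close> be the zero set of \<open>f\<close> and suppose that a fraction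
  \<open>\<delta>\<close> of the pairs in \<open>Z \<times> Z\<close> is violating. For small \<open>\<delta>\<close>, the sums of two \<open>z \<in> Z\<close> for which
  \<open>Z + z\<close> nearly coincides with \<open>Z\<close> form a subspace that differs from \<open>Z\<close> in \<open>O(\<delta> |Z|)\<close> points;
  for large \<open>\<delta>\<close> the empty set does. If \<open>f\<close> is \<open>\<epsilon>\<close>-far, then \<open>\<epsilon> 2\<^sup>n = O(\<delta> |Z|)\<close> and, comparing
  with the empty set, \<open>\<epsilon> 2\<^sup>n \<le> |Z|\<close>; so a random pair is violating with probability
  \<open>\<delta> |Z|\<^sup>2 / 4\<^sup>n = \<Omega>(\<epsilon>\<^sup>2)\<close>.
\<close>

section \<open>Overlaps of a set with its translates\<close>

lemma F2_add_cancel: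
  assumes "x \<in> F2 n" "y \<in> F2 n"
  shows "x + (x + y) = y" "(x + y) + y = x"
proof -
  have bit: "b + (b + c) = c" "(b + c) + c = b" for b c :: bit
    by (cases b; cases c; simp)+
  show "x + (x + y) = y" "(x + y) + y = x"
    using assms by (auto intro!: eq_vecI simp: bit)
qed

text \<open>For \<open>Z \<subseteq> F2 n\<close> and \<open>v \<in> F2 n\<close> this is the size
  of the intersection of Z with Z + v, and also the number of ordered ways to write v as a sum of
  two elements of Z.\<close>

definition shift_overlap :: "f2vec set \<Rightarrow> f2vec \<Rightarrow> nat" where
  "shift_overlap Z v = card {x \<in> Z. v + x \<in> Z}"

text \<open>Inclusion-exclusion in Z bounds from below the number of x with both
  \<open>u + x\<close> and \<open>v + x\<close> in Z. Each such x yields the point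
  \<open>u + x\<close> counted for \<open>u + v\<close>, because
  \<open>(u + v) + (u + x) = v + x\<close>.\<close>

lemma shift_overlap_add:
  assumes Z: "Z \<subseteq> F2 n" and u: "u \<in> F2 n" and v: "v \<in> F2 n"
  shows "shift_overlap Z u + shift_overlap Z v \<le> shift_overlap Z (u + v) + card Z"
proof -
  have fin: "finite Z"
    using Z finite_F2 finite_subset by blast
  let ?A = "{x \<in> Z. u + x \<in> Z}" and ?B = "{x \<in> Z. v + x \<in> Z}"
  have "card (?A \<inter> ?B) \<le> card {x \<in> Z. (u + v) + x \<in> Z}"
  proof (rule card_inj_on_le)
    show "inj_on (\<lambda>x. u + x) (?A \<inter> ?B)"
      using F2_add_cancel(1)[OF u] Z by (intro inj_on_inverseI[of _ "\<lambda>x. u + x"]) auto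
    have "(u + v) + (u + x) = v + x" if "x \<in> Z" for x
    proof -
      have x: "x \<in> F2 n" using that Z by auto
      have "(u + v) + (u + x) = (v + u) + (u + x)"
        using u v by (simp add: comm_add_vec)
      also have "\<dots> = v + (u + (u + x))"
        using u v x by (simp add: assoc_add_vec[of _ n])
      finally show ?thesis using F2_add_cancel(1)[OF u x] by simp
    qed
    then show "(\<lambda>x. u + x) ` (?A \<inter> ?B) \<subseteq> {x \<in> Z. (u + v) + x \<in> Z}"
      by auto
  qed (use fin in auto)
  moreover have "card ?A + card ?B = card (?A \<union> ?B) + card (?A \<inter> ?B)"
    using fin by (intro card_Un_Int) auto
  moreover have "card (?A \<union> ?B) \<le> card Z"
    using fin by (intro card_mono) auto
  ultimately show ?thesis
    unfolding shift_overlap_def by linarith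
qed

text \<open>Among the x counted by the overlap, at most \<open>card (Z - P)\<close> lie outside P
  and at most as many have \<open>w + x\<close> outside P. Some x avoids both, and
  \<open>w = (w + x) + x\<close>.\<close>

lemma sum_representation:
  assumes Z: "Z \<subseteq> F2 n" and w: "w \<in> F2 n"
    and large: "2 * card (Z - P) < shift_overlap Z w"
  shows "\<exists>a \<in> P. \<exists>b \<in> P. w = a + b"
proof -
  have fin: "finite Z"
    using Z finite_F2 finite_subset by blast
  have inj: "inj_on (\<lambda>x. w + x) Z"
    using F2_add_cancel(1)[OF w] Z by (intro inj_on_inverseI[of _ "\<lambda>x. w + x"]) auto
  let ?R = "{x \<in> Z. w + x \<in> Z - P}"
  have "card ?R \<le> card (Z - P)"
    using fin inj by (intro card_inj_on_le[of "\<lambda>x. w + x"]) (auto intro: inj_on_subset)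
  then have "card ((Z - P) \<union> ?R) \<le> 2 * card (Z - P)"
    using card_Un_le[of "Z - P" ?R] by linarith
  then have "\<not> {x \<in> Z. w + x \<in> Z} \<subseteq> (Z - P) \<union> ?R"
    using large fin card_mono[of "(Z - P) \<union> ?R" "{x \<in> Z. w + x \<in> Z}"]
    unfolding shift_overlap_def by auto
  then obtain x where x: "x \<in> Z" "x \<in> P" "w + x \<in> P"
    by auto
  then have "w = (w + x) + x"
    using F2_add_cancel(2)[OF w, of x] Z by auto
  with x show ?thesis by blast
qed

section \<open>Approximation of a set by a subspace or the empty set\<close>

text \<open>With B violating pairs, N = \<open>card Z\<close> and \<delta> = B / N^2, this bounds
  the symmetric difference by 32 \<delta> N; clearing denominators covers empty Z.\<close>

lemma additive_closure_approximation:
  assumes Z: "Z \<subseteq> F2 n"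
  shows "\<exists>V \<subseteq> F2 n. (\<forall>x \<in> V. \<forall>y \<in> V. x + y \<in> V) \<and>
    card ((Z - V) \<union> (V - Z)) * card Z \<le> 32 * card (SIGMA x:Z. {y \<in> Z. x + y \<notin> Z})"
proof -
  have fin: "finite Z"
    using Z finite_F2 finite_subset by blast
  define N where "N = card Z"
  define B where "B = card (SIGMA x:Z. {y \<in> Z. x + y \<notin> Z})"
  show ?thesis
  proof (cases "N * N \<le> 32 * B")
    case True
    then show ?thesis
      by (intro exI[of _ "{}"]) (simp add: N_def B_def)
  next
    case False
    \<comment> \<open>The threshold 7/8 survives two additions: sums of two points of P have overlap
      above 3N/4, and sums of two points of V above N/2. The latter suffices for
      \<open>sum_representation\<close> once D < N/4.\<close>
    define P where "P = {z \<in> Z. 7 * N < 8 * shift_overlap Z z}"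
    define D where "D = card (Z - P)"
    define V where "V = {a + b | a b. a \<in> P \<and> b \<in> P}"
    have PZ: "P \<subseteq> Z" by (auto simp: P_def)
    have VF: "V \<subseteq> F2 n"
      using PZ Z add_carrier_vec unfolding V_def by blast
    have finV: "finite V" using VF finite_F2 finite_subset by blast
    have missed: "card {y \<in> Z. x + y \<notin> Z} + shift_overlap Z x = N" for x
    proof -
      have "card ({y \<in> Z. x + y \<notin> Z} \<union> {y \<in> Z. x + y \<in> Z})
          = card {y \<in> Z. x + y \<notin> Z} + card {y \<in> Z. x + y \<in> Z}"
        using fin by (intro card_Un_disjoint) auto
      moreover have "{y \<in> Z. x + y \<notin> Z} \<union> {y \<in> Z. x + y \<in> Z} = Z" by auto
      ultimately show ?thesis by (simp add: shift_overlap_def N_def)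
    qed
    \<comment> \<open>Double counting: each point of \<open>Z - P\<close> is the first entry of at
      least N/8 violating pairs.\<close>
    have "D * N = (\<Sum>x \<in> Z - P. N)" by (simp add: D_def)
    also have "\<dots> \<le> (\<Sum>x \<in> Z - P. 8 * card {y \<in> Z. x + y \<notin> Z})"
    proof (rule sum_mono)
      fix x assume "x \<in> Z - P"
      then show "N \<le> 8 * card {y \<in> Z. x + y \<notin> Z}"
        using missed[of x] by (auto simp: P_def)
    qed
    also have "\<dots> \<le> (\<Sum>x \<in> Z. 8 * card {y \<in> Z. x + y \<notin> Z})"
      using fin by (intro sum_mono2) auto
    also have "\<dots> = 8 * B"
      using fin by (simp add: B_def card_SigmaI sum_distrib_left)
    finally have DN: "D * N \<le> 8 * B" .
    then have "(4 * D) * N < N * N" using False by linarith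
    then have D: "4 * D < N" by simp
    have overlap_V: "3 * N < 4 * shift_overlap Z v" if "v \<in> V" for v
    proof -
      from that obtain a b where ab: "v = a + b" "a \<in> P" "b \<in> P" by (auto simp: V_def)
      then have "7 * N < 8 * shift_overlap Z a" "7 * N < 8 * shift_overlap Z b"
        "a \<in> F2 n" "b \<in> F2 n"
        using PZ Z by (auto simp: P_def)
      then show ?thesis
        using shift_overlap_add[OF Z, of a b] unfolding ab N_def by linarith
    qed
    have in_V: "w \<in> V" if "w \<in> F2 n" "N < 2 * shift_overlap Z w" for w
      using sum_representation[OF Z that(1), of P] that(2) D unfolding D_def V_def by auto
    have closed: "u + v \<in> V" if uv: "u \<in> V" "v \<in> V" for u v
    proof (rule in_V)
      show "u + v \<in> F2 n" using uv VF add_carrier_vec by blast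
      show "N < 2 * shift_overlap Z (u + v)"
        using shift_overlap_add[OF Z subsetD[OF VF uv(1)] subsetD[OF VF uv(2)]]
          overlap_V[OF uv(1)] overlap_V[OF uv(2)]
        unfolding N_def by linarith
    qed
    have "P \<subseteq> V"
    proof
      fix z assume z: "z \<in> P"
      then have "7 * N < 8 * shift_overlap Z z" by (simp add: P_def)
      then show "z \<in> V" using in_V[of z] z PZ Z by auto
    qed
    then have "card (Z - V) \<le> D"
      unfolding D_def using fin by (intro card_mono) auto
    then have ZV: "card (Z - V) * N \<le> 8 * B"
      using DN by (meson le_trans mult_le_mono1)
    \<comment> \<open>Each v in \<open>V - Z\<close> is a sum of two elements of Z in more than 3N/4
      ways, and each way is a violating pair. Distinct v give distinct pairs.\<close>
    have "card (V - Z) * (3 * N) = (\<Sum>v \<in> V - Z. 3 * N)" by simp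
    also have "\<dots> \<le> (\<Sum>v \<in> V - Z. 4 * shift_overlap Z v)"
      using overlap_V by (intro sum_mono) (simp add: less_imp_le)
    also have "\<dots> = 4 * card (SIGMA v:V - Z. {x \<in> Z. v + x \<in> Z})"
      using fin finV by (simp add: shift_overlap_def card_SigmaI sum_distrib_left)
    finally have "3 * (card (V - Z) * N) \<le> 4 * card (SIGMA v:V - Z. {x \<in> Z. v + x \<in> Z})"
      by simp
    moreover have "card (SIGMA v:V - Z. {x \<in> Z. v + x \<in> Z}) \<le> B"
      unfolding B_def
    proof (rule card_inj_on_le)
      let ?g = "\<lambda>(v, x). (v + x, x)"
      have cancel: "(v + x) + x = v" if "v \<in> V - Z" "x \<in> Z" for v x
        using that Z VF by (intro F2_add_cancel(2)[of _ n]) auto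
      show "inj_on ?g (SIGMA v:V - Z. {x \<in> Z. v + x \<in> Z})"
        using cancel by (intro inj_on_inverseI[of _ "\<lambda>(w, x). (w + x, x)"]) auto
      show "?g ` (SIGMA v:V - Z. {x \<in> Z. v + x \<in> Z}) \<subseteq> (SIGMA x:Z. {y \<in> Z. x + y \<notin> Z})"
        using cancel by auto
    qed (use fin in auto)
    ultimately have VZ: "3 * (card (V - Z) * N) \<le> 4 * B" by linarith
    have "card ((Z - V) \<union> (V - Z)) * N \<le> card (Z - V) * N + card (V - Z) * N"
      by (metis add_mult_distrib card_Un_le mult_le_mono1)
    \<comment> \<open>Here 8 + 4/3 would do; 32 comes from the case split, which needs it for D <
      N/4.\<close>
    also have "\<dots> \<le> 32 * B" using ZV VZ by linarith
    finally show ?thesis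
      using closed VF unfolding N_def B_def by blast
  qed
qed

section \<open>Free functions and distance\<close>

lemma mset_exactly_one_True:
  "{#a, b, c#} = {#True, False, False#} \<longleftrightarrow>
     a \<and> \<not> b \<and> \<not> c \<or> \<not> a \<and> b \<and> \<not> c \<or> \<not> a \<and> \<not> b \<and> c"
proof
  assume "{#a, b, c#} = {#True, False, False#}"
  then have "count {#a, b, c#} True = count {#True, False, False#} True"
    by (rule arg_cong)
  then show "a \<and> \<not> b \<and> \<not> c \<or> \<not> a \<and> b \<and> \<not> c \<or> \<not> a \<and> \<not> b \<and> c"
    by (simp split: if_splits)
next
  have "{#False, True, False#} = {#True, False, False#}"
    "{#False, False, True#} = {#True, False, False#}"
    by (rule multiset_eqI, simp)+
  moreover assume "a \<and> \<not> b \<and> \<not> c \<or> \<not> a \<and> b \<and> \<not> c \<or> \<not> a \<and> \<not> b \<and> c"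
  ultimately show "{#a, b, c#} = {#True, False, False#}"
    by (cases a; cases b; cases c) simp_all
qed

text \<open>In characteristic 2 any two of x, y, x + y sum to the third, so closure rules out
  exactly two of them lying in V.\<close>

lemma free_100_of_closed:
  assumes V: "V \<subseteq> F2 n" and closed: "\<And>x y. x \<in> V \<Longrightarrow> y \<in> V \<Longrightarrow> x + y \<in> V"
  shows "restrict (\<lambda>x. x \<notin> V) (F2 n) \<in> free_100 n"
proof -
  have "{#x \<notin> V, y \<notin> V, x + y \<notin> V#} \<noteq> {#True, False, False#}"
    if xy: "x \<in> F2 n" "y \<in> F2 n" for x y
  proof -
    have "x + y \<in> V" if "x \<in> V" "y \<in> V" using closed that .
    moreover have "x \<in> V" if "x + y \<in> V" "y \<in> V"
      using closed[OF that] F2_add_cancel(2)[OF xy] by simp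
    moreover have "y \<in> V" if "x \<in> V" "x + y \<in> V"
      using closed[OF that] F2_add_cancel(1)[OF xy] by simp
    ultimately show ?thesis
      unfolding mset_exactly_one_True by blast
  qed
  then show ?thesis
    by (auto simp: free_100_def boolean_functions_def)
qed

lemma card_F2_pos: "card (F2 n) > 0"
  using finite_F2 F2_nonempty by (simp add: card_gt_0_iff)

lemma fun_dist_card: "fun_dist n f g = card {x \<in> F2 n. f x \<noteq> g x} / card (F2 n)"
  unfolding fun_dist_def
  by (simp add: measure_pmf_of_set finite_F2 F2_nonempty Int_def)

lemma property_dist_le_free_100:
  assumes "g \<in> free_100 n"
  shows "property_dist n f free_100 \<le> fun_dist n f g"
  unfolding property_dist_def using assms finite_free_100 by (intro Min_le) auto

lemma property_dist_free_100_le_1: "property_dist n f free_100 \<le> 1"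
proof -
  obtain g where "g \<in> free_100 n" using free_100_nonempty by blast
  moreover have "fun_dist n f g \<le> 1" by (simp add: fun_dist_def)
  ultimately show ?thesis using property_dist_le_free_100 order_trans by blast
qed

section \<open>Rejection probability of a single test\<close>

text \<open>Only one arrangement of the forbidden triple is tested; on \<open>F2 n\<close> the other
  two are this one for the pairs (y, x + y) and (x, x + y).\<close>

definition triple_ok :: "(f2vec \<Rightarrow> bool) \<Rightarrow> f2vec \<times> f2vec \<Rightarrow> bool" where
  "triple_ok f p \<longleftrightarrow> f (fst p) \<or> f (snd p) \<or> \<not> f (fst p + snd p)"

lemma prob_triple_ok:
  assumes eps: "\<epsilon> > 0" and far: "property_dist n f free_100 \<ge> \<epsilon>"
  shows "measure_pmf.prob (pmf_of_set (F2 n \<times> F2 n)) {p. triple_ok f p} \<le> 1 - \<epsilon>\<^sup>2 / 32"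
proof -
  define Z where "Z = {x \<in> F2 n. \<not> f x}"
  define K where "K = real (card (F2 n))"
  define B where "B = (SIGMA x:Z. {y \<in> Z. x + y \<notin> Z})"
  have K: "K > 0" using card_F2_pos by (simp add: K_def)
  have far_card: "\<epsilon> * K \<le> card ((Z - V) \<union> (V - Z))"
    if V: "V \<subseteq> F2 n" and closed: "\<And>x y. x \<in> V \<Longrightarrow> y \<in> V \<Longrightarrow> x + y \<in> V" for V
  proof -
    have "{x \<in> F2 n. f x \<noteq> restrict (\<lambda>x. x \<notin> V) (F2 n) x} = (Z - V) \<union> (V - Z)"
      using V by (auto simp: Z_def)
    then have "\<epsilon> \<le> card ((Z - V) \<union> (V - Z)) / K"
      using far property_dist_le_free_100[OF free_100_of_closed[OF V closed], of f]
      by (simp add: fun_dist_card K_def)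
    then show ?thesis using K by (simp add: field_simps)
  qed
  obtain V where V: "V \<subseteq> F2 n" "\<forall>x \<in> V. \<forall>y \<in> V. x + y \<in> V"
    and le: "card ((Z - V) \<union> (V - Z)) * card Z \<le> 32 * card B"
    using additive_closure_approximation[of Z n] unfolding B_def Z_def by blast
  \<comment> \<open>The first factor uses the distance to V, the second the distance to the empty
    set, whose symmetric difference with Z is Z itself.\<close>
  have "(\<epsilon> * K) * (\<epsilon> * K) \<le> real (card ((Z - V) \<union> (V - Z))) * real (card Z)"
    using far_card[of V] far_card[of "{}"] V eps K by (intro mult_mono) auto
  also have "\<dots> \<le> 32 * real (card B)"
    using le by (metis of_nat_le_iff of_nat_mult of_nat_numeral)
  finally have B: "\<epsilon>\<^sup>2 / 32 \<le> card B / (K * K)"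
    using K by (simp add: field_simps power2_eq_square)
  let ?p = "pmf_of_set (F2 n \<times> F2 n)"
  have "measure_pmf.prob ?p {p. triple_ok f p} = 1 - measure_pmf.prob ?p {p. \<not> triple_ok f p}"
    using measure_pmf.prob_compl[of "{p. \<not> triple_ok f p}" ?p] by (simp add: Diff_eq Collect_neg_eq)
  also have "(F2 n \<times> F2 n) \<inter> {p. \<not> triple_ok f p} = B"
    by (auto simp: B_def Z_def triple_ok_def)
  then have "measure_pmf.prob ?p {p. \<not> triple_ok f p} = card B / (K * K)"
    by (simp add: measure_pmf_of_set finite_F2 F2_nonempty K_def card_cartesian_product)
  finally show ?thesis using B by linarith
qed

section \<open>Independent repetition and the tester\<close>

lemma prob_pair_pmf_Times:
  "measure_pmf.prob (pair_pmf p q) (A \<times> B) = measure_pmf.prob p A * measure_pmf.prob q B"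
proof -
  have "measure_pmf.prob (pair_pmf p q) (A \<times> B)
      = measure_pmf.prob (pair_pmf p q) ((A \<inter> set_pmf p) \<times> (B \<inter> set_pmf q))"
    by (subst measure_Int_set_pmf[symmetric]) (simp add: Times_Int_Times)
  \<comment> \<open>Cutting down to the supports makes both sets countable, as the product rule
    requires.\<close>
  also have "\<dots> = measure_pmf.prob p (A \<inter> set_pmf p) * measure_pmf.prob q (B \<inter> set_pmf q)"
    by (rule measure_pmf_prob_product) auto
  finally show ?thesis by (simp add: measure_Int_set_pmf)
qed

lemma prob_replicate_pmf_list_all:
  "measure_pmf.prob (replicate_pmf m p) {xs. list_all P xs} = measure_pmf.prob p {x. P x} ^ m"
proof (induction m)
  case 0
  then show ?case by simp
next
  case (Suc m)
  have "replicate_pmf (Suc m) p = map_pmf (\<lambda>(x, xs). x # xs) (pair_pmf p (replicate_pmf m p))"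
    by (simp add: pair_pmf_def map_bind_pmf)
  moreover have "(\<lambda>(x, xs). x # xs) -` {xs. list_all P xs} = {x. P x} \<times> {xs. list_all P xs}"
    by auto
  ultimately have "measure_pmf.prob (replicate_pmf (Suc m) p) {xs. list_all P xs}
      = measure_pmf.prob (pair_pmf p (replicate_pmf m p)) ({x. P x} \<times> {xs. list_all P xs})"
    by simp
  also have "\<dots> = measure_pmf.prob p {x. P x} * measure_pmf.prob (replicate_pmf m p) {xs. list_all P xs}"
    by (rule prob_pair_pmf_Times)
  finally show ?case by (simp add: Suc.IH)
qed

primrec triples_tree :: "(f2vec \<times> f2vec) list \<Rightarrow> f2vec query_tree" where
  "triples_tree [] = Answer True"
| "triples_tree (p # ps) = (let t = triples_tree ps in
     Query (fst p) (Query (snd p) (Query (fst p + snd p) t (Answer False)) t) t)"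

lemma accepts_triples_tree: "accepts (triples_tree ps) f \<longleftrightarrow> list_all (triple_ok f) ps"
  by (induction ps) (auto simp: Let_def triple_ok_def)

lemma max_queries_triples_tree: "max_queries (triples_tree ps) = 3 * length ps"
  by (induction ps) (auto simp: Let_def)

lemma set_triples_tree:
  "set ps \<subseteq> F2 n \<times> F2 n \<Longrightarrow> set_query_tree (triples_tree ps) \<subseteq> F2 n"
  by (induction ps) (auto simp: Let_def)

definition triples_tester :: "nat \<Rightarrow> nat \<Rightarrow> f2vec query_tree pmf" where
  "triples_tester m n = map_pmf triples_tree (replicate_pmf m (pmf_of_set (F2 n \<times> F2 n)))"

lemma set_replicate_F2_pairs:
  "ps \<in> set_pmf (replicate_pmf m (pmf_of_set (F2 n \<times> F2 n))) \<longleftrightarrow>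
     set ps \<subseteq> F2 n \<times> F2 n \<and> length ps = m"
  by (auto simp: set_replicate_pmf finite_F2 F2_nonempty)

lemma prob_triples_tester:
  "measure_pmf.prob (triples_tester m n) {t. accepts t f} =
     measure_pmf.prob (pmf_of_set (F2 n \<times> F2 n)) {p. triple_ok f p} ^ m"
  by (simp add: triples_tester_def accepts_triples_tree vimage_def
      prob_replicate_pmf_list_all)

lemma free_100_triple_ok:
  assumes f: "f \<in> free_100 n" and p: "p \<in> F2 n \<times> F2 n"
  shows "triple_ok f p"
proof (rule ccontr)
  assume "\<not> triple_ok f p"
  then have "{#f (fst p), f (snd p), f (fst p + snd p)#} = {#True, False, False#}"
    by (simp add: triple_ok_def mset_exactly_one_True)
  then show False using f p by (auto simp: free_100_def)
qed

text \<open>Distances are at most 1, so the bound on m is needed only for \<epsilon> \<le> 1. There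
  64 = 2 * 32 brings the acceptance probability of far functions down to exp (-2).\<close>

lemma one_sided_triples_tester:
  assumes eps: "\<epsilon> > 0" and m: "\<epsilon> \<le> 1 \<Longrightarrow> 64 / \<epsilon>\<^sup>2 \<le> real m"
  shows "one_sided_tester free_100 n \<epsilon> (3 * m) (triples_tester m n)"
  unfolding one_sided_tester_def
proof (intro conjI ballI impI)
  fix t assume "t \<in> set_pmf (triples_tester m n)"
  then obtain ps where "t = triples_tree ps" "set ps \<subseteq> F2 n \<times> F2 n" "length ps = m"
    by (auto simp: triples_tester_def set_replicate_F2_pairs)
  then show "set_query_tree t \<subseteq> F2 n" "max_queries t \<le> 3 * m"
    by (simp_all add: set_triples_tree max_queries_triples_tree)
next
  fix f assume "f \<in> free_100 n"
  then have "AE p in measure_pmf (pmf_of_set (F2 n \<times> F2 n)). triple_ok f p"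
    by (auto simp: AE_measure_pmf_iff finite_F2 F2_nonempty
        intro: free_100_triple_ok)
  then have "measure_pmf.prob (pmf_of_set (F2 n \<times> F2 n)) {p. triple_ok f p} = 1"
    by (simp add: measure_pmf.prob_eq_1)
  then show "measure_pmf.prob (triples_tester m n) {t. accepts t f} = 1"
    by (simp add: prob_triples_tester)
next
  fix f assume far: "\<epsilon> \<le> property_dist n f free_100"
  then have "\<epsilon> \<le> 1" using property_dist_free_100_le_1 order_trans by blast
  have "measure_pmf.prob (triples_tester m n) {t. accepts t f} \<le> (1 - \<epsilon>\<^sup>2 / 32) ^ m"
    unfolding prob_triples_tester
    by (rule power_mono[OF prob_triple_ok[OF eps far] measure_nonneg])
  also have "\<dots> \<le> exp (- (\<epsilon>\<^sup>2 / 32)) ^ m"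
  proof (rule power_mono)
    show "1 - \<epsilon>\<^sup>2 / 32 \<le> exp (- (\<epsilon>\<^sup>2 / 32))"
      using exp_ge_add_one_self[of "- (\<epsilon>\<^sup>2 / 32)"] by simp
    have "\<epsilon>\<^sup>2 \<le> 1" using eps \<open>\<epsilon> \<le> 1\<close> by (simp add: power_le_one)
    then show "0 \<le> 1 - \<epsilon>\<^sup>2 / 32" by simp
  qed
  also have "\<dots> = exp (- (real m * \<epsilon>\<^sup>2 / 32))"
    by (simp flip: exp_of_nat_mult)
  also have "\<dots> \<le> exp (- 2)"
    using m[OF \<open>\<epsilon> \<le> 1\<close>] eps by (simp add: field_simps)
  \<comment> \<open>From exp 2 \<ge> 1 + 2.\<close>
  also have "exp (- 2) \<le> (1 / 3 :: real)"
    using exp_ge_add_one_self[of "2 :: real"] by (simp add: exp_minus field_simps)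
  finally show "measure_pmf.prob (triples_tester m n) {t. accepts t f} \<le> 1 / 3" .
qed

theorem theorem4p2:
  "\<exists>q :: real \<Rightarrow> nat.
     (\<exists>C :: real. \<forall>\<epsilon> > 0. real (q \<epsilon>) \<le> C / \<epsilon>\<^sup>2) \<and>
     testable_with free_100 q"
proof -
  \<comment> \<open>For \<open>\<epsilon> > 1\<close> no function is \<open>\<epsilon>\<close>-far, and \<open>C / \<epsilon>\<^sup>2\<close> eventually permits no query at all.\<close>
  define m :: "real \<Rightarrow> nat" where "m \<epsilon> = (if \<epsilon> \<le> 1 then nat \<lceil>64 / \<epsilon>\<^sup>2\<rceil> else 0)" for \<epsilon>
  \<comment> \<open>195 = 3 * (64 + 1): the 1 lost in the ceiling is at most
    \<open>1 / \<epsilon>\<^sup>2\<close> when \<epsilon> \<le> 1.\<close>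
  have "real (3 * m \<epsilon>) \<le> 195 / \<epsilon>\<^sup>2" if "\<epsilon> > 0" for \<epsilon>
  proof (cases "\<epsilon> \<le> 1")
    case True
    have "real (m \<epsilon>) \<le> 64 / \<epsilon>\<^sup>2 + 1"
      using True by (simp add: m_def)
    moreover have "1 \<le> 1 / \<epsilon>\<^sup>2"
      using True that by (simp add: power_le_one)
    ultimately show ?thesis by (simp add: field_simps)
  qed (simp add: m_def)
  moreover have "one_sided_tester free_100 n \<epsilon> (3 * m \<epsilon>) (triples_tester (m \<epsilon>) n)"
    if "\<epsilon> > 0" for \<epsilon> n
    by (rule one_sided_triples_tester[OF that]) (simp add: m_def real_nat_ceiling_ge)
  then have "testable_with free_100 (\<lambda>\<epsilon>. 3 * m \<epsilon>)"
    unfolding testable_with_def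
    by (intro exI[of _ "\<lambda>\<epsilon>. triples_tester (m \<epsilon>)"] allI impI)
  ultimately show ?thesis
    by (intro exI[of _ "\<lambda>\<epsilon>. 3 * m \<epsilon>"] conjI exI[of _ 195] allI impI)
qed

end
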